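(* Let $n\ge 4$ and let $a,s,b,t$ be four distinct vertices of $K_n$. Orient every edge of $K_n$ independently in one of its two directions, each with probability $1/2$. Let $A$ be the event that there is no directed path from $s$ to $a$, and $B$ the event that there is no directed path from $t$ to $b$. Then $A$ and $B$ are positively correlated, i.e. $\mathbb{P}(A\cap B)>\mathbb{P}(A)\mathbb{P}(B)$. *)

theory Defs
  imports "HOL-Probability.Product_PMF" "Graph_Theory.Pair_Digraph"
begin

definition complete_edges :: "'a set \<Rightarrow> 'a set set" where
  "complete_edges V = {e. e \<subseteq> V \<and> card e = 2}"

text \<open>
  An orientation \<open>\<omega>\<close> maps each edge to the endpoint it points to (its head). Outside the
  edge set of the graph its value is irrelevant; the random orientation below fixes it
  to \<open>undefined\<close> there.
\<close>

definition oriented_complete :: "'a set \<Rightarrow> ('a set \<Rightarrow> 'a) \<Rightarrow> ('a, 'a \<times> 'a) pre_digraph" where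
  "oriented_complete V \<omega> =
     with_proj \<lparr> pverts = V,
                 parcs = {(u, v). {u, v} \<in> complete_edges V \<and> \<omega> {u, v} = v} \<rparr>"

text \<open>For an edge \<open>e\<close>, \<open>pmf_of_set e\<close> picks each of the two endpoints with probability 1/2.\<close>

definition random_orientation :: "'a set \<Rightarrow> ('a set \<Rightarrow> 'a) pmf" where
  "random_orientation V = Pi_pmf (complete_edges V) undefined (\<lambda>e. pmf_of_set e)"

definition no_dipath :: "'a set \<Rightarrow> 'a \<Rightarrow> 'a \<Rightarrow> ('a set \<Rightarrow> 'a) set" where
  "no_dipath V u v = {\<omega>. \<not> (\<exists>p. pre_digraph.apath (oriented_complete V \<omega>) u p v)}"

end

theory Submission
  imports Defs
begin

text \<open>
  Write \<open>x = (1/2) ^ n\<close>. There is no path from \<open>s\<close> to \<open>a\<close> iff all edges between some set \<open>S\<close>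
  containing \<open>s\<close> but not \<open>a\<close> and its complement point into \<open>S\<close>. The cheapest way is that \<open>s\<close> is
  a sink or \<open>a\<close> a source, so \<open>P(A) = P(B)\<close> is about \<open>4 x\<close>. Both events occur together
  if \<open>a\<close> and \<open>b\<close> beat all other vertices, if \<open>s\<close> and \<open>t\<close> lose to all other vertices, if \<open>a\<close> is
  a source and \<open>t\<close> a sink, or if \<open>b\<close> is a source and \<open>s\<close> a sink; this gives about
  \<open>(16 + 16 + 8 + 8) x\<^sup>2 = 48 x\<^sup>2\<close>, three times \<open>P(A) P(B)\<close>. The room between \<open>16\<close> and \<open>48\<close>
  lets a union bound for \<open>P(A)\<close> and a Bonferroni inequality for the intersection succeed for
  every \<open>n \<ge> 5\<close>. For \<open>n = 4\<close> the first two of the four events coincide, and one of them is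
  dropped.
\<close>

section \<open>Events prescribing the direction of given edges\<close>

text \<open>Indexing events by arc sets turns intersections of events into unions of arc sets, so
  every probability below reduces to a cardinality.\<close>

definition arcs_present :: "('a \<times> 'a) set \<Rightarrow> ('a set \<Rightarrow> 'a) set" where
  "arcs_present F = {\<omega>. \<forall>(u, v)\<in>F. \<omega> {u, v} = v}"

definition arc_rel :: "'a set \<Rightarrow> ('a set \<Rightarrow> 'a) \<Rightarrow> ('a \<times> 'a) set" where
  "arc_rel V \<omega> = {(u, v). u \<in> V \<and> v \<in> V \<and> u \<noteq> v \<and> \<omega> {u, v} = v}"

lemma arcs_present_Un: "arcs_present (F \<union> G) = arcs_present F \<inter> arcs_present G"
  by (auto simp: arcs_present_def)

lemma arcs_present_mono: "G \<subseteq> F \<Longrightarrow> arcs_present F \<subseteq> arcs_present G"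
  by (auto simp: arcs_present_def)

lemma arcs_present_opposite:
  assumes "(u, v) \<in> F" "(v, u) \<in> G" "u \<noteq> v"
  shows "arcs_present F \<inter> arcs_present G = {}"
proof -
  have "\<omega> {u, v} = v \<and> \<omega> {v, u} = u" if "\<omega> \<in> arcs_present F \<inter> arcs_present G" for \<omega>
    using that assms by (auto simp: arcs_present_def)
  then show ?thesis
    using assms(3) by (fastforce simp: insert_commute)
qed

lemma measure_pmf_Un:
  "measure_pmf.prob p (A \<union> B) = measure_pmf.prob p A + measure_pmf.prob p B - measure_pmf.prob p (A \<inter> B)"
  by (rule measure_Un3) (auto simp: measure_pmf.fmeasurable_eq_sets)

lemma finite_complete_edges: "finite V \<Longrightarrow> finite (complete_edges V)"
  unfolding complete_edges_def by (rule finite_subset[of _ "Pow V"]) auto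

text \<open>Asymmetry of \<open>F\<close> makes distinct arcs use distinct edges. The event is then
  a product over the edges: an edge carrying an arc of \<open>F\<close> contributes 1/2, any other
  edge contributes 1.\<close>

lemma prob_arcs_present:
  assumes fin: "finite V" and F: "F \<subseteq> V \<times> V" and asym: "\<And>u v. (u, v) \<in> F \<Longrightarrow> (v, u) \<notin> F"
  shows "measure_pmf.prob (random_orientation V) (arcs_present F) = (1/2) ^ card F"
proof -
  define E where "E = complete_edges V"
  define edge where "edge = (\<lambda>(u, v). {u, v} :: 'a set)"
  define B where "B e = {x. \<forall>(u, v)\<in>F. {u, v} = e \<longrightarrow> x = v}" for e
  have neq: "u \<noteq> v" if "(u, v) \<in> F" for u v
    using asym that by auto
  have finE: "finite E"
    unfolding E_def using fin by (rule finite_complete_edges)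
  have inj: "inj_on edge F"
    by (intro inj_onI) (auto simp: edge_def doubleton_eq_iff dest: asym)
  have sub: "edge ` F \<subseteq> E"
    using F neq by (force simp: edge_def E_def complete_edges_def card_2_iff)
  have eq: "arcs_present F = Pi E B"
    using sub by (fastforce simp: arcs_present_def B_def Pi_def edge_def)
  have factor: "measure_pmf.prob (pmf_of_set e) (B e) = (if e \<in> edge ` F then 1/2 else 1)"
    if e: "e \<in> E" for e
  proof (cases "e \<in> edge ` F")
    case True
    then obtain u v where uv: "(u, v) \<in> F" "e = {u, v}"
      by (auto simp: edge_def)
    have "B e = {v}"
      using uv by (auto simp: B_def doubleton_eq_iff dest: asym)
    then show ?thesis
      using True uv neq[OF uv(1)] by (simp add: measure_pmf_of_set)
  next
    case False
    then have "B e = UNIV"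
      by (force simp: B_def edge_def)
    with False show ?thesis
      by simp
  qed
  have "measure_pmf.prob (random_orientation V) (arcs_present F)
      = (\<Prod>e\<in>E. measure_pmf.prob (pmf_of_set e) (B e))"
    unfolding eq random_orientation_def E_def[symmetric] using finE by (rule measure_Pi_pmf_Pi)
  also have "\<dots> = (\<Prod>e\<in>E. if e \<in> edge ` F then 1/2 else 1)"
    using factor by (rule prod.cong[OF refl])
  also have "\<dots> = (1/2) ^ card (edge ` F)"
    using finE sub by (simp add: prod.If_cases Int_absorb1)
  finally show ?thesis
    using inj by (simp add: card_image)
qed

lemma half_power_shift:
  assumes "m + j = k"
  shows "(1/2) ^ m = 2 ^ j * (1/2 :: real) ^ k"
  unfolding assms[symmetric] by (simp add: power_add power_one_over)

text \<open>With \<open>k\<close> a multiple of \<open>n\<close>, every probability becomes a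
  constant times a power of \<open>x\<close>, and exponents such as 2n - 3 avoid truncated
  subtraction.\<close>

lemma prob_arcs_present_shift:
  assumes "finite V" "F \<subseteq> V \<times> V" "\<And>u v. (u, v) \<in> F \<Longrightarrow> (v, u) \<notin> F" "card F + j = k"
  shows "measure_pmf.prob (random_orientation V) (arcs_present F) = 2 ^ j * (1/2) ^ k"
  unfolding half_power_shift[OF assms(4), symmetric] using assms(1-3) by (rule prob_arcs_present)

section \<open>Paths, clusters and cuts\<close>

lemma no_dipath_iff:
  assumes "u \<in> V"
  shows "\<omega> \<in> no_dipath V u v \<longleftrightarrow> (u, v) \<notin> (arc_rel V \<omega>)\<^sup>*"
proof -
  define R where "R = arc_rel V \<omega>"
  have D: "oriented_complete V \<omega> = with_proj \<lparr>pverts = V, parcs = R\<rparr>"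
    unfolding oriented_complete_def R_def arc_rel_def complete_edges_def
    by (intro arg_cong[of _ _ with_proj]) (auto simp: card_2_iff doubleton_eq_iff)
  interpret wf_digraph "oriented_complete V \<omega>"
    by unfold_locales (auto simp: D R_def arc_rel_def)
  have "(u, w) \<in> rtrancl_on V R" if "(u, w) \<in> R\<^sup>*" for w
    using that
  proof induction
    case (step y z)
    then show ?case
      by (auto intro: rtrancl_on_into_rtrancl_on simp: R_def arc_rel_def)
  qed (use assms in auto)
  moreover have "(u, w) \<in> R\<^sup>*" if "(u, w) \<in> rtrancl_on V R" for w
    using that by (rule rtrancl_on_rtranclI)
  ultimately have "u \<rightarrow>\<^sup>*\<^bsub>oriented_complete V \<omega>\<^esub> v \<longleftrightarrow> (u, v) \<in> R\<^sup>*"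
    by (auto simp: reachable_def D)
  then show ?thesis
    by (auto simp: no_dipath_def reachable_apath R_def)
qed

text \<open>A path from \<open>u\<close> to \<open>v\<close> would have to leave \<open>S\<close>,
  but every edge between \<open>S\<close> and its complement points into \<open>S\<close>.\<close>

lemma cut_subset_no_dipath:
  assumes "S \<subseteq> V" "u \<in> S" "v \<notin> S"
  shows "arcs_present ((V - S) \<times> S) \<subseteq> no_dipath V u v"
proof
  fix \<omega> assume w: "\<omega> \<in> arcs_present ((V - S) \<times> S)"
  have "w \<in> S" if "(u, w) \<in> (arc_rel V \<omega>)\<^sup>*" for w
    using that
  proof induction
    case (step y z)
    show ?case
    proof (rule ccontr)
      assume "z \<notin> S"
      with step.IH step.hyps w have "\<omega> {z, y} = y" "\<omega> {y, z} = z" "y \<noteq> z"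
        by (auto simp: arcs_present_def arc_rel_def)
      then show False
        by (simp add: insert_commute)
    qed
  qed (use assms in auto)
  then show "\<omega> \<in> no_dipath V u v"
    using assms by (subst no_dipath_iff) auto
qed

text \<open>An arbitrary \<open>\<omega>\<close> may send an edge to a vertex off that edge. On the
  support this cannot happen, so an edge that does not point to one end points to the other.\<close>

lemma random_orientation_head:
  assumes "finite V" "\<omega> \<in> set_pmf (random_orientation V)" "u \<in> V" "v \<in> V" "u \<noteq> v"
  shows "\<omega> {u, v} \<in> {u, v}"
proof -
  have "{u, v} \<in> complete_edges V"
    using assms by (auto simp: complete_edges_def)
  then have "\<omega> {u, v} \<in> set_pmf (pmf_of_set {u, v})"
    using assms(2) unfolding random_orientation_def
    by (auto simp: set_Pi_pmf finite_complete_edges[OF assms(1)] PiE_dflt_def)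
  then show ?thesis
    by simp
qed

text \<open>
  The cases are those of the size of the out-cluster \<open>S\<close> of \<open>s\<close>. If it exceeds both 2 and
  \<open>card V - 3\<close>, then the in-cluster of \<open>a\<close>, being disjoint from \<open>S\<close>, has size at most 2, and size
  2 only if \<open>5 \<le> card V\<close>. In clusters of size 2 the extra arc inside the cluster halves the
  probability, without which the bound would be too weak for small \<open>n\<close>.
\<close>

lemma no_dipath_subset:
  assumes fin: "finite V" and "s \<in> V" "a \<in> V" "a \<noteq> s"
  shows "no_dipath V s a \<inter> set_pmf (random_orientation V) \<subseteq>
     (arcs_present ((V - {s}) \<times> {s}) \<union> arcs_present ({a} \<times> (V - {a})))
     \<union> (\<Union>x\<in>V - {s, a}. arcs_present (insert (s, x) ((V - {s, x}) \<times> {s, x})))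
     \<union> (\<Union>x\<in>{x \<in> V - {s, a}. 5 \<le> card V}. arcs_present (insert (x, a) ({a, x} \<times> (V - {a, x}))))
     \<union> (\<Union>T\<in>{T. T \<subseteq> V - {s, a} \<and> 2 \<le> card T \<and> card T + 4 \<le> card V}.
          arcs_present ((V - insert s T) \<times> insert s T))"
    (is "_ \<subseteq> ?A \<union> ?B \<union> ?C \<union> ?D")
proof
  fix \<omega> assume w: "\<omega> \<in> no_dipath V s a \<inter> set_pmf (random_orientation V)"
  define R where "R = arc_rel V \<omega>"
  define S where "S = {v. (s, v) \<in> R\<^sup>*}"
  define D where "D = {v. (v, a) \<in> R\<^sup>*}"
  have sa: "(s, a) \<notin> R\<^sup>*"
    using w assms by (simp add: no_dipath_iff R_def)
  have "v \<in> V" if "(s, v) \<in> R\<^sup>*" for v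
    using that by (cases rule: rtranclE) (use assms in \<open>auto simp: R_def arc_rel_def\<close>)
  then have SV: "S \<subseteq> V" by (auto simp: S_def)
  have "v \<in> V" if "(v, a) \<in> R\<^sup>*" for v
    using that by (cases rule: converse_rtranclE) (use assms in \<open>auto simp: R_def arc_rel_def\<close>)
  then have DV: "D \<subseteq> V" by (auto simp: D_def)
  have sS: "s \<in> S" "a \<notin> S" and aD: "a \<in> D" "s \<notin> D"
    using sa by (auto simp: S_def D_def)
  have SD: "S \<inter> D = {}"
    using sa by (auto simp: S_def D_def dest: rtrancl_trans)
  have finS: "finite S" and finD: "finite D"
    using SV DV fin by (auto intro: finite_subset)
  have arc: "\<omega> {u, v} = v" if "u \<in> V" "v \<in> V" "u \<noteq> v" "(v, u) \<notin> R" for u v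
    using random_orientation_head[of V \<omega> u v] that w fin
    by (auto simp: R_def arc_rel_def insert_commute)
  \<comment> \<open>An edge pointing out of \<open>S\<close> would make its head reachable from
    \<open>s\<close>.\<close>
  have cutS: "\<omega> \<in> arcs_present ((V - S) \<times> S)"
  proof -
    have "\<omega> {u, v} = v" if "u \<in> V - S" "v \<in> S" for u v
      using that SV by (intro arc) (auto simp: S_def intro: rtrancl_into_rtrancl)
    then show ?thesis by (auto simp: arcs_present_def)
  qed
  have cutD: "\<omega> \<in> arcs_present (D \<times> (V - D))"
  proof -
    have "\<omega> {u, v} = v" if "u \<in> D" "v \<in> V - D" for u v
      using that DV by (intro arc) (auto simp: D_def intro: converse_rtrancl_into_rtrancl)
    then show ?thesis by (auto simp: arcs_present_def)
  qed
  \<comment> \<open>The first arc on a path from \<open>s\<close> to \<open>x\<close> stays in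
    \<open>S\<close> and leaves \<open>s\<close>, so it must end in \<open>x\<close>.\<close>
  have sx: "\<omega> {s, x} = x" if xx: "S = {s, x}" "x \<noteq> s" for x
  proof -
    have "(s, x) \<in> R\<^sup>*" using that by (auto simp: S_def)
    then obtain y where y: "(s, y) \<in> R" 
      using xx(2) by (auto elim: converse_rtranclE)
    then have "y \<in> S" "y \<noteq> s" by (auto simp: S_def R_def arc_rel_def)
    with y that show ?thesis by (auto simp: R_def arc_rel_def)
  qed
  have xa: "\<omega> {x, a} = a" if xx: "D = {a, x}" "x \<noteq> a" for x
  proof -
    have "(x, a) \<in> R\<^sup>*" using that by (auto simp: D_def)
    then obtain y where y: "(y, a) \<in> R" 
      using xx(2) by (auto elim: rtranclE)
    then have "y \<in> D" "y \<noteq> a" by (auto simp: D_def R_def arc_rel_def)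
    with y that show ?thesis by (auto simp: R_def arc_rel_def)
  qed
  have "card S + card D \<le> card V"
    using SV DV SD finS finD fin by (metis Un_least card_Un_disjoint card_mono)
  moreover have "card S \<ge> 1" "card D \<ge> 1"
    using sS aD finS finD by (auto simp: Suc_le_eq card_gt_0_iff)
  ultimately consider "card S = 1" | "card D = 1" | "card S = 2" | "card D = 2" "5 \<le> card V"
    | "3 \<le> card S" "card S + 3 \<le> card V"
    by linarith
  then show "\<omega> \<in> ?A \<union> ?B \<union> ?C \<union> ?D"
  proof cases
    case 1
    then have "S = {s}" using sS by (auto simp: card_1_singleton_iff)
    with cutS show ?thesis by simp
  next
    case 2
    then have "D = {a}" using aD by (auto simp: card_1_singleton_iff)
    with cutD show ?thesis by simp
  next
    case 3
    then obtain x where x: "S = {s, x}" "x \<noteq> s" using sS by (auto simp: card_2_iff)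
    with sS SV have "x \<in> V - {s, a}" by auto
    moreover have "\<omega> \<in> arcs_present (insert (s, x) ((V - {s, x}) \<times> {s, x}))"
      using cutS sx[OF x] unfolding x by (simp add: arcs_present_def)
    ultimately show ?thesis by blast
  next
    case 4
    then obtain x where x: "D = {a, x}" "x \<noteq> a" using aD by (auto simp: card_2_iff)
    with aD DV 4 have "x \<in> {x \<in> V - {s, a}. 5 \<le> card V}" by auto
    moreover have "\<omega> \<in> arcs_present (insert (x, a) ({a, x} \<times> (V - {a, x})))"
      using cutD xa[OF x] unfolding x by (simp add: arcs_present_def)
    ultimately show ?thesis by blast
  next
    case 5
    \<comment> \<open>The index set is \<open>S\<close> without \<open>s\<close>, which turns the
      size condition with 3 into the one with 4.\<close>
    have "insert s (S - {s}) = S" "card (S - {s}) = card S - 1"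
      using sS finS by auto
    then have "\<omega> \<in> arcs_present ((V - insert s (S - {s})) \<times> insert s (S - {s}))"
        "S - {s} \<in> {T. T \<subseteq> V - {s, a} \<and> 2 \<le> card T \<and> card T + 4 \<le> card V}"
      using 5 cutS SV sS by auto
    then show ?thesis by blast
  qed
qed

section \<open>Upper bound for the probability of one event\<close>

text \<open>The two stars have \<open>card V - 1\<close> arcs each and share exactly
  \<open>(a, s)\<close>.\<close>

lemma card_source_sink:
  assumes "finite V" "s \<in> V" "a \<in> V" "a \<noteq> s"
  shows "card ({a} \<times> (V - {a}) \<union> (V - {s}) \<times> {s}) = 2 * card V - 3"
proof -
  have "{a} \<times> (V - {a}) \<union> (V - {s}) \<times> {s} = {a} \<times> (V - {a}) \<union> (V - {s, a}) \<times> {s}"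
    using assms by auto
  also have "card \<dots> = (card V - 1) + (card V - 2)"
    using assms by (subst card_Un_disjoint) (auto simp: card_cartesian_product)
  also have "\<dots> = 2 * card V - 3"
    using assms card_mono[of V "{s, a}"] by simp
  finally show ?thesis .
qed

text \<open>Union bound over the cover in \<open>no_dipath_subset\<close>, except that sink and
  source are treated exactly: 2x + 2x - 8x^2. Each cluster of size 2 costs 8x^2 and has n - 2
  choices, on both sides if n >= 5 but on one side only if n = 4; each of the \<open>N\<close>
  middle sets costs at most 512x^3.\<close>

lemma prob_no_dipath_le:
  fixes V :: "'a set"
  assumes fin: "finite V" and V: "s \<in> V" "a \<in> V" "a \<noteq> s" and n: "card V = n" "4 \<le> n"
  defines "x \<equiv> (1/2) ^ n :: real"
    and "N \<equiv> card {T. T \<subseteq> V - {s, a} \<and> 2 \<le> card T \<and> card T + 4 \<le> n}"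
  shows "measure_pmf.prob (random_orientation V) (no_dipath V s a)
       \<le> 4 * x - 8 * x\<^sup>2 + (if n = 4 then 8 else 16) * (real n - 2) * x\<^sup>2 + 512 * real N * x ^ 3"
proof -
  let ?P = "measure_pmf.prob (random_orientation V)"
  let ?A1 = "arcs_present ((V - {s}) \<times> {s})"
  let ?A2 = "arcs_present ({a} \<times> (V - {a}))"
  let ?B = "\<lambda>x. arcs_present (insert (s, x) ((V - {s, x}) \<times> {s, x}))"
  let ?C = "\<lambda>x. arcs_present (insert (x, a) ({a, x} \<times> (V - {a, x})))"
  let ?K = "{x \<in> V - {s, a}. 5 \<le> n}"
  let ?I = "{T. T \<subseteq> V - {s, a} \<and> 2 \<le> card T \<and> card T + 4 \<le> n}"
  let ?D = "\<lambda>T. arcs_present ((V - insert s T) \<times> insert s T)"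
  note [simp] = n(1)
  have x2: "x\<^sup>2 = (1/2) ^ (2 * n)" and x3: "x ^ 3 = (1/2) ^ (3 * n)"
    by (simp_all add: x_def power_mult[symmetric] mult.commute)
  have "?P ?A1 = 2 ^ 1 * (1/2) ^ n" "?P ?A2 = 2 ^ 1 * (1/2) ^ n"
    by (intro prob_arcs_present_shift; use fin V n in \<open>auto simp: card_cartesian_product\<close>)+
  moreover have "?P (?A1 \<inter> ?A2) = 2 ^ 3 * (1/2) ^ (2 * n)"
    unfolding arcs_present_Un[symmetric] using fin V n card_source_sink[OF fin V]
    by (intro prob_arcs_present_shift) (auto simp: Un_commute)
  moreover have "?P (?A1 \<union> ?A2) = ?P ?A1 + ?P ?A2 - ?P (?A1 \<inter> ?A2)"
    by (rule measure_pmf_Un)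
  ultimately have A: "?P (?A1 \<union> ?A2) = 4 * x - 8 * x\<^sup>2"
    unfolding x2 by (simp add: x_def)
  have pB: "?P (?B y) = 8 * x\<^sup>2" and pC: "?P (?C y) = 8 * x\<^sup>2" if y: "y \<in> V - {s, a}" for y
  proof -
    have c2: "card (V - {s, y}) = n - 2" "card (V - {a, y}) = n - 2"
      using fin V y by auto
    \<comment> \<open>The cut has 2(n - 2) arcs, and the arc inside the cluster adds one.\<close>
    have "card (insert (s, y) ((V - {s, y}) \<times> {s, y})) = 2 * n - 3"
      using fin V y n c2 by (subst card_insert_disjoint) (auto simp: card_cartesian_product)
    then have "?P (?B y) = 2 ^ 3 * (1/2) ^ (2 * n)"
      using fin V y n by (intro prob_arcs_present_shift) auto
    then show "?P (?B y) = 8 * x\<^sup>2"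
      by (simp add: x2)
    have "card (insert (y, a) ({a, y} \<times> (V - {a, y}))) = 2 * n - 3"
      using fin V y n c2 by (subst card_insert_disjoint) (auto simp: card_cartesian_product)
    then have "?P (?C y) = 2 ^ 3 * (1/2) ^ (2 * n)"
      using fin V y n by (intro prob_arcs_present_shift) auto
    then show "?P (?C y) = 8 * x\<^sup>2"
      by (simp add: x2)
  qed
  have pD: "?P (?D T) \<le> 512 * x ^ 3" if T: "T \<in> ?I" for T
  proof -
    define k where "k = card T"
    have k: "2 \<le> k" "k + 4 \<le> n" and T': "T \<subseteq> V" "s \<notin> T" "finite T"
      using T fin by (auto simp: k_def intro: finite_subset)
    have "card ((V - insert s T) \<times> insert s T) = (n - Suc k) * Suc k"
      using T' V fin by (simp add: card_cartesian_product card_Diff_subset k_def)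
    then have eq: "?P (?D T) = (1/2) ^ ((n - Suc k) * Suc k)"
      using T' V fin by (subst prob_arcs_present) auto
    \<comment> \<open>Both factors of the cut size are at least 3: they are j + 3 and i + 3, with
      product at least 3i + 3j + 9 = 3n - 9.\<close>
    obtain i j where ij: "k = i + 2" "n = i + j + 6"
      using k by (intro that[of "k - 2" "n - k - 4"]) auto
    have "3 * n - 9 \<le> (n - Suc k) * Suc k"
      unfolding ij by (simp add: algebra_simps)
    then have "?P (?D T) \<le> (1/2) ^ (3 * n - 9)"
      unfolding eq by (intro power_decreasing) auto
    also have "\<dots> = 2 ^ 9 * (1/2) ^ (3 * n)"
      using n by (intro half_power_shift) auto
    also have "\<dots> = 512 * x ^ 3"
      by (simp add: x3)
    finally show ?thesis .
  qed
  have "card (V - {s, a}) = n - 2"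
    using fin V by simp
  moreover have "?K = (if n = 4 then {} else V - {s, a})"
    using n by auto
  ultimately have cards: "card (V - {s, a}) = n - 2" "card ?K = (if n = 4 then 0 else n - 2)"
    by simp_all
  have "?P (no_dipath V s a) = ?P (no_dipath V s a \<inter> set_pmf (random_orientation V))"
    by (simp add: measure_Int_set_pmf)
  also have "\<dots> \<le> ?P ((?A1 \<union> ?A2) \<union> (\<Union>y\<in>V - {s, a}. ?B y) \<union> (\<Union>y\<in>?K. ?C y) \<union> (\<Union>T\<in>?I. ?D T))"
    using no_dipath_subset[OF fin V] by (intro measure_pmf.finite_measure_mono) auto
  also have "\<dots> \<le> ?P (?A1 \<union> ?A2) + ?P (\<Union>y\<in>V - {s, a}. ?B y) + ?P (\<Union>y\<in>?K. ?C y) + ?P (\<Union>T\<in>?I. ?D T)"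
    by (intro order_trans[OF measure_Un_le] add_mono order_refl) auto
  also have "?P (\<Union>y\<in>V - {s, a}. ?B y) \<le> (\<Sum>y\<in>V - {s, a}. ?P (?B y))"
    using fin by (intro measure_pmf.finite_measure_subadditive_finite) auto
  also have "\<dots> = (\<Sum>y\<in>V - {s, a}. 8 * x\<^sup>2)"
    by (intro sum.cong refl pB)
  also have "?P (\<Union>y\<in>?K. ?C y) \<le> (\<Sum>y\<in>?K. ?P (?C y))"
    using fin by (intro measure_pmf.finite_measure_subadditive_finite) auto
  also have "\<dots> = (\<Sum>y\<in>?K. 8 * x\<^sup>2)"
    by (intro sum.cong refl pC) auto
  also have "?P (\<Union>T\<in>?I. ?D T) \<le> (\<Sum>T\<in>?I. ?P (?D T))"
    using fin by (intro measure_pmf.finite_measure_subadditive_finite) auto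
  also have "\<dots> \<le> (\<Sum>T\<in>?I. 512 * x ^ 3)"
    by (intro sum_mono pD)
  also have "?P (?A1 \<union> ?A2) + (\<Sum>y\<in>V - {s, a}. 8 * x\<^sup>2) + (\<Sum>y\<in>?K. 8 * x\<^sup>2) + (\<Sum>T\<in>?I. 512 * x ^ 3)
      = 4 * x - 8 * x\<^sup>2 + (if n = 4 then 8 else 16) * (real n - 2) * x\<^sup>2 + 512 * real N * x ^ 3"
    unfolding sum_constant cards A N_def[symmetric]
    using of_nat_diff[of 2 n, where 'a = real] n(2) by (cases "n = 4") simp_all
  finally show ?thesis
    by simp
qed

text \<open>To be used with \<open>U\<close> equal to \<open>V\<close> without two vertices. The
  crude bound serves n >= 7; for n = 5 and n = 6 it would be too weak, hence the exact
  values.\<close>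

lemma card_middle_sets:
  assumes "finite U"
  shows "card {T. T \<subseteq> U \<and> 2 \<le> card T \<and> card T + 4 \<le> card U + 2} \<le> 2 ^ card U"
    and "card U \<le> 3 \<Longrightarrow> card {T. T \<subseteq> U \<and> 2 \<le> card T \<and> card T + 4 \<le> card U + 2} = 0"
    and "card U = 4 \<Longrightarrow> card {T. T \<subseteq> U \<and> 2 \<le> card T \<and> card T + 4 \<le> card U + 2} = 6"
proof -
  show "card {T. T \<subseteq> U \<and> 2 \<le> card T \<and> card T + 4 \<le> card U + 2} \<le> 2 ^ card U"
    unfolding card_Pow[OF assms, symmetric] using assms by (intro card_mono) auto
  show "card {T. T \<subseteq> U \<and> 2 \<le> card T \<and> card T + 4 \<le> card U + 2} = 0" if "card U \<le> 3"
    using that assms by (subst card_eq_0_iff) auto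
  assume U: "card U = 4"
  then have "{T. T \<subseteq> U \<and> 2 \<le> card T \<and> card T + 4 \<le> card U + 2} = {T. T \<subseteq> U \<and> card T = 2}"
    by auto
  then show "card {T. T \<subseteq> U \<and> 2 \<le> card T \<and> card T + 4 \<le> card U + 2} = 6"
    using n_subsets[OF assms, of 2] U by (simp add: choose_two)
qed

section \<open>Lower bound for the probability of the intersection\<close>

text \<open>Beyond the 2(n - 2) arcs leaving the pair, only \<open>(i, k)\<close> and the n - 3 arcs
  into \<open>j\<close> from outside the pair are new.\<close>

lemma card_pair_dominates_source_sink:
  assumes "finite V" "i \<in> V" "k \<in> V" "j \<in> V" "i \<noteq> k" "i \<noteq> j" "k \<noteq> j"
  shows "card ({i, k} \<times> (V - {i, k}) \<union> ({i} \<times> (V - {i}) \<union> (V - {j}) \<times> {j})) + 6 = 3 * card V"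
proof -
  have ge: "3 \<le> card V"
    using card_mono[of V "{i, k, j}"] assms by simp
  have eq: "{i, k} \<times> (V - {i, k}) \<union> ({i} \<times> (V - {i}) \<union> (V - {j}) \<times> {j})
      = {i, k} \<times> (V - {i, k}) \<union> insert (i, k) ((V - {i, k, j}) \<times> {j})"
    using assms by auto
  have disj: "{i, k} \<times> (V - {i, k}) \<inter> insert (i, k) ((V - {i, k, j}) \<times> {j}) = {}"
    by auto
  have "card (V - {i, k}) = card V - 2" "card (V - {i, k, j}) = card V - 3"
    using assms by auto
  then have "card ({i, k} \<times> (V - {i, k})) = 2 * (card V - 2)"
    and "card (insert (i, k) ((V - {i, k, j}) \<times> {j})) = Suc (card V - 3)"
    using assms by (simp_all add: card_cartesian_product)
  then have "card ({i, k} \<times> (V - {i, k}) \<union> insert (i, k) ((V - {i, k, j}) \<times> {j}))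
      = 2 * (card V - 2) + Suc (card V - 3)"
    using disj assms(1) by (subst card_Un_disjoint) simp_all
  then show ?thesis
    unfolding eq using ge by simp
qed

text \<open>Inclusion-exclusion for the first two events joined with the disjoint union of the last
  two; only the overlap of the two halves is estimated, by four pairwise terms. The second bound
  drops the event of \<open>?F2\<close>, which equals that of \<open>?F1\<close> when n = 4.\<close>

lemma prob_no_dipath_Int_ge:
  fixes V :: "'a set"
  assumes fin: "finite V" and V: "{a, s, b, t} \<subseteq> V" and dist: "distinct [a, s, b, t]"
    and n: "card V = n"
  defines "x \<equiv> (1/2) ^ n :: real"
    and "p \<equiv> measure_pmf.prob (random_orientation V) (no_dipath V s a \<inter> no_dipath V t b)"
  shows "48 * x\<^sup>2 - 256 * x ^ 3 - 4096 * x ^ 4 \<le> p"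
    and "32 * x\<^sup>2 - 128 * x ^ 3 \<le> p"
proof -
  let ?P = "measure_pmf.prob (random_orientation V)"
  let ?F1 = "{a, b} \<times> (V - {a, b})" and ?F2 = "(V - {s, t}) \<times> {s, t}"
  let ?F3 = "{a} \<times> (V - {a}) \<union> (V - {t}) \<times> {t}"
  let ?F4 = "{b} \<times> (V - {b}) \<union> (V - {s}) \<times> {s}"
  let ?E = arcs_present
  have ne: "a \<noteq> s" "a \<noteq> b" "a \<noteq> t" "s \<noteq> b" "s \<noteq> t" "b \<noteq> t"
    using dist by auto
  note ne' = ne ne[symmetric]
  have mem: "a \<in> V" "s \<in> V" "b \<in> V" "t \<in> V"
    using V by auto
  have n4: "4 \<le> n"
    using card_mono[OF fin V] ne n by simp
  have xp: "x\<^sup>2 = (1/2) ^ (2 * n)" "x ^ 3 = (1/2) ^ (3 * n)" "x ^ 4 = (1/2) ^ (4 * n)"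
    by (simp_all add: x_def power_mult[symmetric] mult.commute)
  have card_minus: "card (V - A) = n - card A" if "A \<subseteq> V" for A
    using that fin n by (simp add: card_Diff_subset finite_subset)
  have "?P (?E ?F1) = 2 ^ 4 * (1/2) ^ (2 * n)"
    using fin mem ne' n4 n card_minus[of "{a, b}"]
    by (intro prob_arcs_present_shift) (auto simp: card_cartesian_product)
  then have P1: "?P (?E ?F1) = 16 * x\<^sup>2"
    by (simp add: xp)
  have "?P (?E ?F2) = 2 ^ 4 * (1/2) ^ (2 * n)"
    using fin mem ne' n4 n card_minus[of "{s, t}"]
    by (intro prob_arcs_present_shift) (auto simp: card_cartesian_product)
  then have P2: "?P (?E ?F2) = 16 * x\<^sup>2"
    by (simp add: xp)
  have "?P (?E ?F3) = 2 ^ 3 * (1/2) ^ (2 * n)"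
    using fin mem ne' n4 n card_source_sink[of V t a]
    by (intro prob_arcs_present_shift) (auto)
  then have P3: "?P (?E ?F3) = 8 * x\<^sup>2"
    by (simp add: xp)
  have "?P (?E ?F4) = 2 ^ 3 * (1/2) ^ (2 * n)"
    using fin mem ne' n4 n card_source_sink[of V s b]
    by (intro prob_arcs_present_shift) (auto)
  then have P4: "?P (?E ?F4) = 8 * x\<^sup>2"
    by (simp add: xp)
  \<comment> \<open>The two sets of 2(n - 2) arcs share the four arcs from \<open>a\<close>,
    \<open>b\<close> to \<open>s\<close>, \<open>t\<close>.\<close>
  have "card (?F1 \<union> ?F2) = card (?F1 \<union> (V - {a, b, s, t}) \<times> {s, t})"
    using mem ne by (intro arg_cong[of _ _ card]) auto
  also have "\<dots> = 4 * n - 12"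
    using fin mem ne' n4 card_minus[of "{a, b}"] card_minus[of "{a, b, s, t}"]
    by (subst card_Un_disjoint) (auto simp: card_cartesian_product)
  finally have "?P (?E (?F1 \<union> ?F2)) = 2 ^ 12 * (1/2) ^ (4 * n)"
    using fin mem ne' n4 by (intro prob_arcs_present_shift) auto
  then have P12: "?P (?E ?F1 \<inter> ?E ?F2) = 4096 * x ^ 4"
    by (simp add: arcs_present_Un xp)
  have P1ij: "?P (?E ({a, b} \<times> (V - {a, b})) \<inter> ?E ({i} \<times> (V - {i}) \<union> (V - {j}) \<times> {j})) = 64 * x ^ 3"
    if ij: "{i, k} = {a, b}" "i \<noteq> k" "j \<in> V" "j \<noteq> a" "j \<noteq> b" for i j k
  proof -
    have ik: "i \<in> V" "k \<in> V" "i \<noteq> j" "k \<noteq> j"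
      using ij mem by (auto simp: doubleton_eq_iff)
    have "card ({i, k} \<times> (V - {i, k}) \<union> ({i} \<times> (V - {i}) \<union> (V - {j}) \<times> {j})) + 6 = 3 * n"
      using card_pair_dominates_source_sink[OF fin, of i k j] ij(2,3) ik n by simp
    then have "?P (?E ({i, k} \<times> (V - {i, k}) \<union> ({i} \<times> (V - {i}) \<union> (V - {j}) \<times> {j}))) = 2 ^ 6 * (1/2) ^ (3 * n)"
      using fin ij(2,3) ik by (intro prob_arcs_present_shift) auto
    then show ?thesis
      unfolding ij(1)[symmetric] by (simp add: arcs_present_Un xp)
  qed
  have P2ij: "?P (?E ((V - {s, t}) \<times> {s, t}) \<inter> ?E ({i} \<times> (V - {i}) \<union> (V - {j}) \<times> {j})) = 64 * x ^ 3"
    if ij: "{j, k} = {s, t}" "j \<noteq> k" "i \<in> V" "i \<noteq> s" "i \<noteq> t" for i j k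
  proof -
    have ik: "j \<in> V" "k \<in> V" "i \<noteq> j" "i \<noteq> k"
      using ij mem by (auto simp: doubleton_eq_iff)
    \<comment> \<open>Reversing all arcs exchanges sources and sinks, so the earlier count
      applies.\<close>
    have "(V - {j, k}) \<times> {j, k} \<union> ({i} \<times> (V - {i}) \<union> (V - {j}) \<times> {j})
        = ({j, k} \<times> (V - {j, k}) \<union> ({j} \<times> (V - {j}) \<union> (V - {i}) \<times> {i}))\<inverse>"
      by auto
    then have "card ((V - {j, k}) \<times> {j, k} \<union> ({i} \<times> (V - {i}) \<union> (V - {j}) \<times> {j})) + 6 = 3 * n"
      using card_pair_dominates_source_sink[OF fin, of j k i] ij(2,3) ik n by (simp add: card_inverse)
    then have "?P (?E ((V - {j, k}) \<times> {j, k} \<union> ({i} \<times> (V - {i}) \<union> (V - {j}) \<times> {j}))) = 2 ^ 6 * (1/2) ^ (3 * n)"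
      using fin ij(2,3) ik by (intro prob_arcs_present_shift) auto
    then show ?thesis
      unfolding ij(1)[symmetric] by (simp add: arcs_present_Un xp)
  qed
  have P13: "?P (?E ?F1 \<inter> ?E ?F3) = 64 * x ^ 3" and P14: "?P (?E ?F1 \<inter> ?E ?F4) = 64 * x ^ 3"
    using P1ij[of a b t] P1ij[of b a s] mem ne' by (auto simp: insert_commute)
  have P23: "?P (?E ?F2 \<inter> ?E ?F3) = 64 * x ^ 3" and P24: "?P (?E ?F2 \<inter> ?E ?F4) = 64 * x ^ 3"
    using P2ij[of t s a] P2ij[of s t b] mem ne' by (auto simp: insert_commute)
  \<comment> \<open>A source at \<open>a\<close> and a source at \<open>b\<close> disagree on the
    edge between them.\<close>
  have "(a, b) \<in> ?F3" "(b, a) \<in> ?F4"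
    using mem ne' by auto
  then have "?E ?F3 \<inter> ?E ?F4 = {}"
    using ne(2) by (rule arcs_present_opposite)
  then have P34: "?P (?E ?F3 \<union> ?E ?F4) = 16 * x\<^sup>2"
    using P3 P4 by (simp add: measure_pmf_Un)
  \<comment> \<open>Each arc set contains a full cut for each pair: the separating \<open>S\<close>
    is a set of sinks or the complement of a set of sources.\<close>
  have dom: "?E ?F1 \<union> ?E ?F2 \<union> (?E ?F3 \<union> ?E ?F4) \<subseteq> no_dipath V s a \<inter> no_dipath V t b"
  proof -
    have cut: "?E F \<subseteq> no_dipath V u v" if "S \<subseteq> V" "u \<in> S" "v \<notin> S" "(V - S) \<times> S \<subseteq> F" for F S u v
      using cut_subset_no_dipath[OF that(1-3)] arcs_present_mono[OF that(4)] by blast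
    have "?E ?F1 \<subseteq> no_dipath V s a"
      by (rule cut[of "V - {a, b}"]) (use mem ne' in auto)
    moreover have "?E ?F1 \<subseteq> no_dipath V t b"
      by (rule cut[of "V - {a, b}"]) (use mem ne' in auto)
    moreover have "?E ?F2 \<subseteq> no_dipath V s a"
      by (rule cut[of "{s, t}"]) (use mem ne' in auto)
    moreover have "?E ?F2 \<subseteq> no_dipath V t b"
      by (rule cut[of "{s, t}"]) (use mem ne' in auto)
    moreover have "?E ?F3 \<subseteq> no_dipath V s a"
      by (rule cut[of "V - {a}"]) (use mem ne' in auto)
    moreover have "?E ?F3 \<subseteq> no_dipath V t b"
      by (rule cut[of "{t}"]) (use mem ne' in auto)
    moreover have "?E ?F4 \<subseteq> no_dipath V s a"
      by (rule cut[of "{s}"]) (use mem ne' in auto)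
    moreover have "?E ?F4 \<subseteq> no_dipath V t b"
      by (rule cut[of "V - {b}"]) (use mem ne' in auto)
    ultimately show ?thesis
      by blast
  qed
  have le: "?P A \<le> p" if "A \<subseteq> ?E ?F1 \<union> ?E ?F2 \<union> (?E ?F3 \<union> ?E ?F4)" for A
    unfolding p_def using that dom by (intro measure_pmf.finite_measure_mono) auto
  have "?P ((?E ?F1 \<union> ?E ?F2) \<inter> (?E ?F3 \<union> ?E ?F4))
      \<le> ?P ((?E ?F1 \<inter> ?E ?F3 \<union> ?E ?F1 \<inter> ?E ?F4) \<union> (?E ?F2 \<inter> ?E ?F3 \<union> ?E ?F2 \<inter> ?E ?F4))"
    by (intro measure_pmf.finite_measure_mono) auto
  also have "\<dots> \<le> (?P (?E ?F1 \<inter> ?E ?F3) + ?P (?E ?F1 \<inter> ?E ?F4))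
      + (?P (?E ?F2 \<inter> ?E ?F3) + ?P (?E ?F2 \<inter> ?E ?F4))"
    by (intro order_trans[OF measure_Un_le] add_mono measure_Un_le) auto
  finally have "?P ((?E ?F1 \<union> ?E ?F2) \<inter> (?E ?F3 \<union> ?E ?F4)) \<le> 256 * x ^ 3"
    unfolding P13 P14 P23 P24 by simp
  moreover have "?P (?E ?F1 \<union> ?E ?F2) = 32 * x\<^sup>2 - 4096 * x ^ 4"
    unfolding measure_pmf_Un P1 P2 P12 by simp
  moreover have "?P (?E ?F1 \<union> ?E ?F2) + ?P (?E ?F3 \<union> ?E ?F4)
      - ?P ((?E ?F1 \<union> ?E ?F2) \<inter> (?E ?F3 \<union> ?E ?F4)) \<le> p"
    using le[OF order_refl] unfolding measure_pmf_Un[of _ "?E ?F1 \<union> ?E ?F2"] .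
  ultimately show "48 * x\<^sup>2 - 256 * x ^ 3 - 4096 * x ^ 4 \<le> p"
    unfolding P34 by simp
  have "?P (?E ?F1 \<inter> (?E ?F3 \<union> ?E ?F4)) \<le> ?P (?E ?F1 \<inter> ?E ?F3) + ?P (?E ?F1 \<inter> ?E ?F4)"
    unfolding Int_Un_distrib by (rule measure_Un_le) auto
  then have "?P (?E ?F1 \<inter> (?E ?F3 \<union> ?E ?F4)) \<le> 128 * x ^ 3"
    unfolding P13 P14 by simp
  moreover have "?P (?E ?F1 \<union> (?E ?F3 \<union> ?E ?F4)) \<le> p"
    by (rule le) auto
  then have "16 * x\<^sup>2 + 16 * x\<^sup>2 - ?P (?E ?F1 \<inter> (?E ?F3 \<union> ?E ?F4)) \<le> p"
    unfolding measure_pmf_Un[of _ "?E ?F1"] P1 P34 .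
  ultimately show "32 * x\<^sup>2 - 128 * x ^ 3 \<le> p"
    by simp
qed

section \<open>Comparison of the two bounds\<close>

text \<open>Integer form of (16n + 96)x <= 2. It fails at n = 6, which is therefore treated
  separately.\<close>

lemma two_power_ge:
  assumes "7 \<le> n"
  shows "16 * n + 96 \<le> 2 ^ (n + 1)"
  using assms by (induction n rule: dec_induct) auto

theorem theorem2p3:
  fixes V :: "'a set" and n :: nat and a s b t :: 'a
  assumes "n \<ge> 4"
    and "finite V" and "card V = n"
    and "{a, s, b, t} \<subseteq> V" and "distinct [a, s, b, t]"
  shows "measure_pmf.prob (random_orientation V) (no_dipath V s a \<inter> no_dipath V t b)
       > measure_pmf.prob (random_orientation V) (no_dipath V s a)
         * measure_pmf.prob (random_orientation V) (no_dipath V t b)"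
proof -
  let ?P = "measure_pmf.prob (random_orientation V)"
  define x :: real where "x = (1/2) ^ n"
  define N where "N u v = card {T. T \<subseteq> V - {u, v} \<and> 2 \<le> card T \<and> card T + 4 \<le> n}" for u v
  define q where "q m = 4 * x - 8 * x\<^sup>2 + (if n = 4 then 8 else 16) * (real n - 2) * x\<^sup>2 + 512 * real m * x ^ 3" for m
  have x0: "0 < x"
    by (simp add: x_def)
  have V: "s \<in> V" "a \<in> V" "a \<noteq> s" "t \<in> V" "b \<in> V" "b \<noteq> t"
    using assms(4,5) by auto
  have upper: "?P (no_dipath V s a) \<le> q (N s a)" "?P (no_dipath V t b) \<le> q (N t b)"
    unfolding q_def x_def N_def using assms V by (intro prob_no_dipath_le; simp)+
  have N: "N u v \<le> 2 ^ (n - 2)" "n \<le> 5 \<Longrightarrow> N u v = 0" "n = 6 \<Longrightarrow> N u v = 6"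
    if "u \<in> V" "v \<in> V" "v \<noteq> u" for u v
  proof -
    have c: "card (V - {u, v}) = n - 2" "n - 2 + 2 = n" and f: "finite (V - {u, v})"
      using that assms by auto
    show "N u v \<le> 2 ^ (n - 2)" "n \<le> 5 \<Longrightarrow> N u v = 0" "n = 6 \<Longrightarrow> N u v = 6"
      using card_middle_sets[OF f, unfolded c] unfolding N_def by auto
  qed
  have lower: "48 * x\<^sup>2 - 256 * x ^ 3 - 4096 * x ^ 4 \<le> ?P (no_dipath V s a \<inter> no_dipath V t b)"
    "32 * x\<^sup>2 - 128 * x ^ 3 \<le> ?P (no_dipath V s a \<inter> no_dipath V t b)"
    unfolding x_def using assms by (intro prob_no_dipath_Int_ge; simp)+
  have bound: ?thesis
    if "q (N s a) \<le> c" "q (N t b) \<le> c"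
      "c * c < 48 * x\<^sup>2 - 256 * x ^ 3 - 4096 * x ^ 4 \<or> c * c < 32 * x\<^sup>2 - 128 * x ^ 3" for c
  proof -
    have "?P (no_dipath V s a) \<le> c" "?P (no_dipath V t b) \<le> c"
      using upper that by auto
    moreover from this have "0 \<le> c"
      using measure_nonneg order_trans by blast
    ultimately have "?P (no_dipath V s a) * ?P (no_dipath V t b) \<le> c * c"
      by (intro mult_mono) auto
    then show ?thesis
      using lower that(3) by linarith
  qed
  consider "n = 4" | "n = 5" | "n = 6" | "7 \<le> n"
    using assms(1) by linarith
  then show ?thesis
  proof cases
    case 1
    show ?thesis
      \<comment> \<open>9/32 is \<open>q 0\<close> at x = 1/16. Its square 81/1024 lies below the
        second lower bound 96/1024 but above the first, 64/1024.\<close>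
      using N V by (intro bound[of "9/32"]) (simp_all add: 1 q_def x_def power_divide)
  next
    case 2
    show ?thesis
      \<comment> \<open>21/128 is \<open>q 0\<close> at x = 1/32.\<close>
      using N V by (intro bound[of "21/128"]) (simp_all add: 2 q_def x_def power_divide)
  next
    case 3
    show ?thesis
      \<comment> \<open>23/256 slightly exceeds \<open>q 6\<close> = 45/512 at x = 1/64.\<close>
      using N V by (intro bound[of "23/256"]) (simp_all add: 3 q_def x_def power_divide)
  next
    case 4
    have x128: "x \<le> 1/128"
      using power_decreasing[OF 4, of "1/2::real"] by (simp add: x_def power_divide)
    have "real (16 * n + 96) \<le> real (2 ^ (n + 1))"
      using two_power_ge[OF 4] by (simp only: of_nat_le_iff)
    then have "(16 * real n + 96) * x \<le> 2"
      by (simp add: x_def power_one_over field_simps)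
    from mult_right_mono[OF this, of x] have lin: "(16 * real n + 96) * x\<^sup>2 \<le> 2 * x"
      using x0 by (simp add: power2_eq_square)
    \<comment> \<open>Since 2^(n - 2) = 1/(4x), the middle sets add at most 128x^2. All terms beyond
      4x then total at most (16n + 88)x^2, which \<open>lin\<close> bounds by 2x.\<close>
    have "q m \<le> 6 * x" if "m \<le> 2 ^ (n - 2)" for m
    proof -
      have "real m \<le> real (2 ^ (n - 2))"
        using that by (simp only: of_nat_le_iff)
      also have "\<dots> = 2 ^ (n - 2)"
        by simp
      also have "\<dots> = 1 / (4 * x)"
        using 4 by (simp add: x_def power_one_over power_diff)
      finally have "real m * (512 * x ^ 3) \<le> 1 / (4 * x) * (512 * x ^ 3)"
        using x0 by (intro mult_right_mono) auto
      also have "\<dots> = 128 * x\<^sup>2"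
        using x0 by (simp add: power2_eq_square power3_eq_cube)
      finally have "real m * (512 * x ^ 3) \<le> 128 * x\<^sup>2" .
      moreover have "q m = 4 * x + (16 * real n + 96) * x\<^sup>2 - 136 * x\<^sup>2 + real m * (512 * x ^ 3)"
        using 4 by (simp add: q_def algebra_simps)
      moreover have "0 \<le> x\<^sup>2"
        by simp
      ultimately show ?thesis
        using lin by linarith
    qed
    \<comment> \<open>Against 36x^2 there remains x^2(12 - 256x - 4096x^2), where x <= 1/128 makes
      the bracket positive.\<close>
    moreover have "6 * x * (6 * x) < 48 * x\<^sup>2 - 256 * x ^ 3 - 4096 * x ^ 4"
    proof -
      have "x * x \<le> 1/128 * (1/128)"
        using x0 x128 by (intro mult_mono) auto
      then have "0 < x * x * (12 - 256 * x - 4096 * (x * x))"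
        using x0 x128 by (intro mult_pos_pos) auto
      then show ?thesis
        by (simp add: power2_eq_square power3_eq_cube power4_eq_xxxx algebra_simps)
    qed
    ultimately show ?thesis
      using N(1) V by (intro bound[of "6 * x"]) simp_all
  qed
qed

end
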